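(* Let $m,r\ge 2$ be integers and let $k,s,p,q\in\mathbb{Z}$. Then the following identity holds in the universal enveloping algebra $U(W_1)$: $$\sum_{i=0}^m\sum_{j=0}^r(-1)^{i+j}\binom{m}{i}\binom{r}{j}\Big(\big\{\Omega^{(m)}_{k-i,s-j},\Omega^{(r)}_{q+i,p+j}\big\}-\big\{\Omega^{(m)}_{k-i,q-j},\Omega^{(r)}_{s+i,p+j}\big\}\Big)$$ $$=(q-s)\Big((p-k+2r)\,\Omega^{(2m+2r-1)}_{k+p+2r,\,s+q-2r}-(p-k+2m)\,\Omega^{(2m+2r-1)}_{k+p+2r-1,\,s+q-2r+1}\Big).$$
   Context: $W_1$ is the Witt algebra over $\mathbb{C}$, with basis $\{e_k: k\in\mathbb{Z}\}$ and bracket $[e_r,e_s]=(s-r)e_{r+s}$. For $m\ge0$ and $k,s\in\mathbb{Z}$ the differentiators are the elements $\Omega^{(m)}_{k,s}=\sum_{i=0}^m(-1)^i\binom{m}{i}e_{k-i}e_{s+i}\in U(W_1)$. $\{X,Y\}=XY+YX$ denotes the anticommutator. *)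

theory Defs
  imports Complex_Main "HOL-Library.Poly_Mapping"
begin

section \<open>The Witt algebra\<close>

text \<open>
  A vector of the Witt algebra over the complex numbers is a finitely supported
  function giving its coordinates with respect to the basis \<open>e\<^sub>k\<close>, \<open>k \<in> \<int>\<close>.
  The convolution product which the library puts on this type is not used.
\<close>

type_synonym witt = "int \<Rightarrow>\<^sub>0 complex"

definition witt_basis :: "int \<Rightarrow> witt" where
  "witt_basis k = Poly_Mapping.single k 1"

definition witt_scale :: "complex \<Rightarrow> witt \<Rightarrow> witt" where
  "witt_scale c x = Poly_Mapping.map ((*) c) x"

text \<open>Bilinear extension of \<open>[e\<^sub>r, e\<^sub>s] = (s - r) e\<^bsub>r+s\<^esub>\<close>.\<close>

definition witt_bracket :: "witt \<Rightarrow> witt \<Rightarrow> witt" where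
  "witt_bracket x y =
     (\<Sum>r\<in>Poly_Mapping.keys x. \<Sum>s\<in>Poly_Mapping.keys y.
        witt_scale (Poly_Mapping.lookup x r * Poly_Mapping.lookup y s * of_int (s - r))
          (witt_basis (r + s)))"

lemma lookup_witt_scale [simp]:
  "Poly_Mapping.lookup (witt_scale c x) k = c * Poly_Mapping.lookup x k"
  by (simp add: witt_scale_def Poly_Mapping.map.rep_eq when_def)

lemma witt_scale_basis: "witt_scale c (witt_basis k) = Poly_Mapping.single k c"
  by (rule poly_mapping_eqI) (simp add: witt_basis_def lookup_single when_def)

lemma witt_bracket_superset:
  assumes "finite A" "Poly_Mapping.keys x \<subseteq> A" "finite B" "Poly_Mapping.keys y \<subseteq> B"
  shows "witt_bracket x y =
     (\<Sum>r\<in>A. \<Sum>s\<in>B. Poly_Mapping.single (r + s)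
        (Poly_Mapping.lookup x r * Poly_Mapping.lookup y s * of_int (s - r)))"
proof -
  have "witt_bracket x y =
     (\<Sum>r\<in>Poly_Mapping.keys x. \<Sum>s\<in>B. Poly_Mapping.single (r + s)
        (Poly_Mapping.lookup x r * Poly_Mapping.lookup y s * of_int (s - r)))"
    unfolding witt_bracket_def witt_scale_basis using assms
    by (intro sum.cong refl sum.mono_neutral_left) (auto simp: in_keys_iff)
  also have "\<dots> = (\<Sum>r\<in>A. \<Sum>s\<in>B. Poly_Mapping.single (r + s)
        (Poly_Mapping.lookup x r * Poly_Mapping.lookup y s * of_int (s - r)))"
    using assms by (intro sum.mono_neutral_left) (auto simp: in_keys_iff)
  finally show ?thesis .
qed

lemma witt_bracket_basis:
  "witt_bracket (witt_basis r) (witt_basis s) = witt_scale (of_int (s - r)) (witt_basis (r + s))"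
  by (subst witt_bracket_superset [of "{r}" _ "{s}"])
     (simp_all add: witt_scale_basis, simp_all add: witt_basis_def)

lemma witt_bracket_add_left: "witt_bracket (x + x') y = witt_bracket x y + witt_bracket x' y"
proof -
  let ?A = "Poly_Mapping.keys x \<union> Poly_Mapping.keys x'" and ?B = "Poly_Mapping.keys y"
  have "Poly_Mapping.keys (x + x') \<subseteq> ?A" by (rule Poly_Mapping.keys_add)
  then show ?thesis
    by (simp add: witt_bracket_superset [of ?A _ ?B] lookup_add algebra_simps
        flip: single_add sum.distrib)
qed

lemma witt_bracket_scale_left: "witt_bracket (witt_scale c x) y = witt_scale c (witt_bracket x y)"
proof -
  have k: "Poly_Mapping.keys (witt_scale c x) \<subseteq> Poly_Mapping.keys x"
    by (auto simp: in_keys_iff)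
  show ?thesis
    by (rule poly_mapping_eqI)
       (simp add: k witt_bracket_superset [of "Poly_Mapping.keys x" _ "Poly_Mapping.keys y"]
          lookup_sum lookup_single when_def sum_distrib_left algebra_simps if_distrib cong: if_cong)
qed

lemma witt_bracket_anti: "witt_bracket y x = - witt_bracket x y"
  unfolding witt_bracket_def witt_scale_basis sum_negf [symmetric]
  by (subst sum.swap, intro sum.cong refl)
     (auto simp: algebra_simps simp flip: single_uminus)

lemma witt_bracket_self: "witt_bracket x x = 0"
proof (rule poly_mapping_eqI)
  fix k
  have "Poly_Mapping.lookup (witt_bracket x x) k = - Poly_Mapping.lookup (witt_bracket x x) k"
    by (metis witt_bracket_anti lookup_uminus)
  then show "Poly_Mapping.lookup (witt_bracket x x) k = Poly_Mapping.lookup 0 k" by simp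
qed

lemma witt_bracket_add_right: "witt_bracket x (y + y') = witt_bracket x y + witt_bracket x y'"
  using witt_bracket_add_left [of y y' x] witt_bracket_anti [of x y] witt_bracket_anti [of x y']
    witt_bracket_anti [of x "y + y'"] by simp

lemma witt_scale_minus: "witt_scale c (- x) = - witt_scale c x"
  by (rule poly_mapping_eqI) simp

lemma witt_bracket_scale_right: "witt_bracket x (witt_scale c y) = witt_scale c (witt_bracket x y)"
  using witt_bracket_scale_left [of c y x] witt_bracket_anti [of x y]
    witt_bracket_anti [of x "witt_scale c y"]
  by (simp add: witt_scale_minus)

lemma witt_induct [case_names zero add]:
  assumes "P 0" and "\<And>c k x. P x \<Longrightarrow> P (witt_scale c (witt_basis k) + x)"
  shows "P x"
proof -
  have "finite A \<Longrightarrow> P (\<Sum>k\<in>A. witt_scale (Poly_Mapping.lookup x k) (witt_basis k))" for A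
    by (induction A rule: finite_induct) (auto intro: assms)
  moreover have "(\<Sum>k\<in>Poly_Mapping.keys x. witt_scale (Poly_Mapping.lookup x k) (witt_basis k)) = x"
    by (rule poly_mapping_eqI)
       (simp add: witt_scale_basis lookup_sum lookup_single when_def in_keys_iff)
  ultimately show ?thesis by (metis finite_keys)
qed

lemma witt_scale_scale: "witt_scale c (witt_scale d x) = witt_scale (c * d) x"
  by (rule poly_mapping_eqI) simp

lemma witt_scale_add: "witt_scale c (x + y) = witt_scale c x + witt_scale c y"
  by (rule poly_mapping_eqI) (simp add: lookup_add algebra_simps)

lemma witt_bracket_zero [simp]: "witt_bracket 0 y = 0" "witt_bracket x 0 = 0"
  by (simp_all add: witt_bracket_def)

lemma witt_jacobi:
  "witt_bracket x (witt_bracket y z) + witt_bracket y (witt_bracket z x)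
     + witt_bracket z (witt_bracket x y) = 0"
proof -
  define J where "J x y z = witt_bracket x (witt_bracket y z) + witt_bracket y (witt_bracket z x)
     + witt_bracket z (witt_bracket x y)" for x y z
  have add: "J (x + x') y z = J x y z + J x' y z" for x x' y z
    by (simp add: J_def witt_bracket_add_left witt_bracket_add_right)
  have scale: "J (witt_scale c x) y z = witt_scale c (J x y z)" for c x y z
    by (simp add: J_def witt_bracket_scale_left witt_bracket_scale_right witt_scale_add)
  have cyc: "J x y z = J y z x" for x y z
    by (simp add: J_def ac_simps)
  have basis: "J (witt_basis a) (witt_basis b) (witt_basis c) = 0" for a b c
  proof -
    have "witt_bracket (witt_basis a) (witt_bracket (witt_basis b) (witt_basis c))
        = Poly_Mapping.single (a + b + c) (of_int ((c - b) * (b + c - a)))" for a b c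
      by (simp only: witt_bracket_basis witt_bracket_scale_right witt_scale_scale)
         (simp only: witt_scale_basis of_int_mult add.assoc)
    moreover have "b + c + a = a + b + c" "c + a + b = a + b + c" by simp_all
    ultimately have "J (witt_basis a) (witt_basis b) (witt_basis c)
        = Poly_Mapping.single (a + b + c)
            (of_int ((c - b) * (b + c - a) + (a - c) * (c + a - b) + (b - a) * (a + b - c)))"
      by (simp only: J_def single_add of_int_add)
    also have "(c - b) * (b + c - a) + (a - c) * (c + a - b) + (b - a) * (a + b - c) = 0"
      by (simp add: algebra_simps)
    finally show ?thesis by simp
  qed
  have sz: "witt_scale c 0 = 0" for c by (rule poly_mapping_eqI) simp
  have z: "J 0 y z = 0" for y z by (simp add: J_def)
  have one: "J x (witt_basis b) (witt_basis c) = 0" for x b c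
    by (induction x rule: witt_induct) (simp_all add: z add scale basis sz)
  have "J (witt_basis b) (witt_basis c) x = 0" for x b c
    using one [of x b c] cyc [of x] by simp
  then have two: "J y (witt_basis c) x = 0" for y x c
    by (induction y rule: witt_induct) (simp_all add: z add scale sz)
  have "J (witt_basis c) x y = 0" for y x c
    using two [of y c x] cyc [of y] by simp
  then have "J z x y = 0" for x y z
    by (induction z rule: witt_induct) (simp_all add: z add scale sz)
  then show ?thesis by (simp add: J_def)
qed


section \<open>The tensor algebra\<close>

text \<open>
  The tensor algebra of the Witt algebra is the free associative unital algebra on
  the basis vectors: the monoid algebra of the free monoid on \<open>\<int>\<close>, in which the
  word \<open>k\<^sub>1 \<dots> k\<^sub>n\<close> stands for \<open>e\<^bsub>k\<^sub>1\<^esub> \<otimes> \<dots> \<otimes> e\<^bsub>k\<^sub>n\<^esub>\<close>.  The free monoid is written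
  additively because the library forms monoid algebras over additive monoids; on
  the type \<open>tensor\<close> the library product is thus the tensor product.
\<close>

datatype word = Word "int list"

instantiation word :: monoid_add
begin

definition zero_word :: word where
  "0 = Word []"

fun plus_word :: "word \<Rightarrow> word \<Rightarrow> word" where
  "Word u + Word v = Word (u @ v)"

instance
proof
  fix a b c :: word
  show "a + b + c = a + (b + c)" by (cases a; cases b; cases c) simp
  show "0 + a = a" "a + 0 = a" by (cases a; simp add: zero_word_def)+
qed

end

type_synonym tensor = "word \<Rightarrow>\<^sub>0 complex"

definition tensor_of :: "witt \<Rightarrow> tensor" where
  "tensor_of x = (\<Sum>k\<in>Poly_Mapping.keys x. Poly_Mapping.single (Word [k]) (Poly_Mapping.lookup x k))"

definition tensor_scale :: "complex \<Rightarrow> tensor \<Rightarrow> tensor" where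
  "tensor_scale c a = Poly_Mapping.map ((*) c) a"

lemma tensor_scale_mult: "tensor_scale c a = Poly_Mapping.single 0 c * a"
  unfolding tensor_scale_def by (rule mult_map_scale_conv_mult)

lemma lookup_tensor_scale: "Poly_Mapping.lookup (tensor_scale c a) w = c * Poly_Mapping.lookup a w"
  by (simp add: tensor_scale_def Poly_Mapping.map.rep_eq when_def)

lemma lookup_tensor_of:
  "Poly_Mapping.lookup (tensor_of x) (Word u) = (if length u = 1 then Poly_Mapping.lookup x (hd u) else 0)"
  by (cases u rule: remdups_adj.cases)
     (auto simp: tensor_of_def lookup_sum lookup_single when_def in_keys_iff)

lemma tensor_of_add: "tensor_of (x + y) = tensor_of x + tensor_of y"
  by (rule poly_mapping_eqI, rename_tac w, case_tac w) (simp add: lookup_tensor_of lookup_add)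

lemma tensor_of_scale: "tensor_of (witt_scale c x) = tensor_scale c (tensor_of x)"
  by (rule poly_mapping_eqI, rename_tac w, case_tac w) (simp add: lookup_tensor_of lookup_tensor_scale)

lemma tensor_of_basis: "tensor_of (witt_basis k) = Poly_Mapping.single (Word [k]) 1"
  by (simp add: tensor_of_def witt_basis_def)

lemma lookup_mult_empty_word:
  "Poly_Mapping.lookup (a * b :: tensor) 0 = Poly_Mapping.lookup a 0 * Poly_Mapping.lookup b 0"
proof -
  have *: "0 = l + q \<longleftrightarrow> l = 0 \<and> q = 0" for l q :: word
    by (cases l; cases q) (auto simp: zero_word_def)
  have "Sum_any (\<lambda>q. Poly_Mapping.lookup b q when 0 = l + q) = (Poly_Mapping.lookup b 0 when l = 0)" for l
  proof (cases "l = 0")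
    case True
    then have "(\<lambda>q. Poly_Mapping.lookup b q when 0 = l + q) = (\<lambda>q. Poly_Mapping.lookup b q when q = 0)"
      by (simp add: fun_eq_iff *)
    then show ?thesis using True by simp
  qed (simp add: *)
  then show ?thesis by (simp add: lookup_mult mult_when)
qed


section \<open>The universal enveloping algebra\<close>

text \<open>
  The two-sided ideal of the tensor algebra generated by the elements
  \<open>x \<otimes> y - y \<otimes> x - [x, y]\<close>.
\<close>

inductive_set uea_ideal :: "tensor set" where
  generator: "tensor_of x * tensor_of y - tensor_of y * tensor_of x - tensor_of (witt_bracket x y) \<in> uea_ideal"
| zero: "0 \<in> uea_ideal"
| add: "a \<in> uea_ideal \<Longrightarrow> b \<in> uea_ideal \<Longrightarrow> a + b \<in> uea_ideal"
| mult_left: "a \<in> uea_ideal \<Longrightarrow> t * a \<in> uea_ideal"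
| mult_right: "a \<in> uea_ideal \<Longrightarrow> a * t \<in> uea_ideal"

lemma uea_ideal_minus: "a \<in> uea_ideal \<Longrightarrow> - a \<in> uea_ideal"
  using uea_ideal.mult_left [of a "- 1"] by simp

lemma uea_ideal_diff: "a \<in> uea_ideal \<Longrightarrow> b \<in> uea_ideal \<Longrightarrow> a - b \<in> uea_ideal"
  using uea_ideal.add [of a "- b"] uea_ideal_minus by simp

lemma uea_ideal_augmentation: "a \<in> uea_ideal \<Longrightarrow> Poly_Mapping.lookup a 0 = 0"
proof (induction rule: uea_ideal.induct)
  case (generator x y)
  have "Poly_Mapping.lookup (tensor_of z) 0 = 0" for z
    by (simp add: zero_word_def lookup_tensor_of)
  then show ?case by (simp add: lookup_minus lookup_mult_empty_word)
qed (simp_all add: lookup_add lookup_mult_empty_word)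

quotient_type uea = tensor / "\<lambda>a b. a - b \<in> uea_ideal"
proof (rule equivpI)
  show "reflp (\<lambda>a b. a - b \<in> uea_ideal)"
    by (simp add: reflp_def uea_ideal.zero)
  show "symp (\<lambda>a b. a - b \<in> uea_ideal)"
    by (rule sympI) (drule uea_ideal_minus, simp)
  show "transp (\<lambda>a b. a - b \<in> uea_ideal)"
    by (rule transpI) (drule (1) uea_ideal.add, simp)
qed

instantiation uea :: ring_1
begin

lift_definition zero_uea :: uea is 0 .

lift_definition one_uea :: uea is 1 .

lift_definition plus_uea :: "uea \<Rightarrow> uea \<Rightarrow> uea" is "(+)"
  by (metis uea_ideal.add add_diff_add)

lift_definition uminus_uea :: "uea \<Rightarrow> uea" is uminus
  by (metis uea_ideal_minus minus_diff_minus)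

lift_definition minus_uea :: "uea \<Rightarrow> uea \<Rightarrow> uea" is "(-)"
proof -
  fix a a' b b' :: tensor
  assume "a - a' \<in> uea_ideal" "b - b' \<in> uea_ideal"
  then have "(a - a') - (b - b') \<in> uea_ideal" by (rule uea_ideal_diff)
  then show "(a - b) - (a' - b') \<in> uea_ideal" by (simp add: algebra_simps)
qed

lift_definition times_uea :: "uea \<Rightarrow> uea \<Rightarrow> uea" is "(*)"
proof -
  fix a a' b b' :: tensor
  assume "a - a' \<in> uea_ideal" "b - b' \<in> uea_ideal"
  then have "(a - a') * b + a' * (b - b') \<in> uea_ideal"
    by (intro uea_ideal.add uea_ideal.mult_left uea_ideal.mult_right)
  then show "a * b - a' * b' \<in> uea_ideal" by (simp add: algebra_simps)
qed

instance
proof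
  show "(0::uea) \<noteq> 1"
    by transfer (auto dest!: uea_ideal_augmentation simp: lookup_minus)
qed (transfer, simp add: algebra_simps uea_ideal.zero)+

end

lift_definition uea_scale :: "complex \<Rightarrow> uea \<Rightarrow> uea" is tensor_scale
  unfolding tensor_scale_mult by (metis uea_ideal.mult_left right_diff_distrib)

lift_definition uea_of :: "witt \<Rightarrow> uea" is tensor_of .

interpretation uea: vector_space uea_scale
proof
  fix a b :: complex and x y :: uea
  show "uea_scale a (x + y) = uea_scale a x + uea_scale a y"
    by transfer (simp add: tensor_scale_mult algebra_simps uea_ideal.zero)
  show "uea_scale (a + b) x = uea_scale a x + uea_scale b x"
    by transfer (simp add: tensor_scale_mult single_add algebra_simps uea_ideal.zero)
  show "uea_scale a (uea_scale b x) = uea_scale (a * b) x"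
    by transfer (simp add: tensor_scale_mult mult_single uea_ideal.zero flip: mult.assoc)
  show "uea_scale 1 x = x"
    by transfer (simp add: tensor_scale_mult uea_ideal.zero)
qed

lemma uea_scale_mult_left: "uea_scale c x * y = uea_scale c (x * y)"
  by transfer (simp add: tensor_scale_mult mult.assoc uea_ideal.zero)

lemma uea_scale_mult_right: "x * uea_scale c y = uea_scale c (x * y)"
proof transfer
  fix x y :: tensor and c :: complex
  have "x * Poly_Mapping.single 0 c = Poly_Mapping.single 0 c * x"
  proof (rule poly_mapping_eqI)
    fix w :: word
    have "Sum_any (\<lambda>q. (c when q = 0) when w = l + q) = (c when l = w)" for l
    proof -
      have "(\<lambda>q. (c when q = 0) when w = l + q) = (\<lambda>q::word. (c when l = w) when q = 0)"
        by (auto simp: fun_eq_iff when_def)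
      then show ?thesis by (simp only: Sum_any_when_equal)
    qed
    then have "Poly_Mapping.lookup (x * Poly_Mapping.single 0 c) w = c * Poly_Mapping.lookup x w"
      by (simp add: lookup_mult lookup_single mult_when eq_commute [of 0] mult.commute)
    then show "Poly_Mapping.lookup (x * Poly_Mapping.single 0 c) w
        = Poly_Mapping.lookup (Poly_Mapping.single 0 c * x) w"
      by (simp add: lookup_tensor_scale flip: tensor_scale_mult)
  qed
  then show "x * tensor_scale c y - tensor_scale c (x * y) \<in> uea_ideal"
    by (simp add: tensor_scale_mult uea_ideal.zero flip: mult.assoc)
qed

lemma uea_of_add: "uea_of (x + y) = uea_of x + uea_of y"
  by transfer (simp add: tensor_of_add uea_ideal.zero)

lemma uea_of_scale: "uea_of (witt_scale c x) = uea_scale c (uea_of x)"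
  by transfer (simp add: tensor_of_scale uea_ideal.zero)

lemma uea_commutator: "uea_of x * uea_of y - uea_of y * uea_of x = uea_of (witt_bracket x y)"
  by transfer (rule uea_ideal.generator)

lemma uea_scale_of_int: "uea_scale (of_int n) x = of_int n * x"
proof -
  have nat: "uea_scale (of_nat m) x = of_nat m * x" for m
    by (induction m) (simp_all add: uea.scale_left_distrib distrib_right)
  show ?thesis
    by (cases n rule: int_cases2) (simp_all add: nat)
qed


section \<open>Differentiators\<close>

definition uea_basis :: "int \<Rightarrow> uea" where
  "uea_basis k = uea_of (witt_basis k)"

lemma uea_basis_commutator:
  "uea_basis r * uea_basis s - uea_basis s * uea_basis r = of_int (s - r) * uea_basis (r + s)"
  by (simp add: uea_basis_def uea_commutator witt_bracket_basis uea_of_scale uea_scale_of_int del: of_int_diff)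

text \<open>
  Integer coefficients are written with the canonical map into the ring; by
  \<open>uea_scale_of_int\<close> this agrees with multiplication by complex scalars.
\<close>

definition differentiator :: "nat \<Rightarrow> int \<Rightarrow> int \<Rightarrow> uea" where
  "differentiator m k s =
     (\<Sum>i=0..m. (- 1) ^ i * of_nat (m choose i) * uea_basis (k - int i) * uea_basis (s + int i))"

definition anticommutator :: "uea \<Rightarrow> uea \<Rightarrow> uea" where
  "anticommutator x y = x * y + y * x"

end

theory Submission
  imports Defs
begin

text \<open>
  Encode \<open>e\<^sub>a e\<^sub>b e\<^sub>c e\<^sub>d\<close> by the monomial \<open>x\<^sup>a y\<^sup>b z\<^sup>c w\<^sup>d\<close>.  The sum of the products
  \<open>\<Omega>\<^sup>m \<Omega>\<^sup>r\<close> is then \<open>x\<^sup>k y\<^sup>s z\<^sup>q w\<^sup>p F\<close>, where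
  \<open>F = (1 - y/x)\<^sup>m (1 - z/x)\<^sup>m (1 - w/y)\<^sup>r (1 - w/z)\<^sup>r\<close>
  is symmetric in \<open>y\<close> and \<open>z\<close>, so exchanging \<open>s\<close> and \<open>q\<close> amounts to exchanging the two
  middle factors, and the difference reduces to their commutator.  In the reversed products
  \<open>e\<^sub>c e\<^sub>d e\<^sub>a e\<^sub>b\<close>, the factor \<open>e\<^sub>c\<close> can be moved past \<open>e\<^sub>d e\<^sub>a\<close> for free: the
  commutators have coefficients linear in the summation index and are killed by differences
  of order \<open>m, r \<ge> 2\<close>.  What remains is \<open>(q - s)\<close> times the sum of \<open>[e\<^sub>a e\<^sub>b, e\<^sub>d]\<close> with
  weights \<open>(1 - y/x)\<^bsup>2m\<^esup> (1 - w/y)\<^bsup>2r\<^esup>\<close>, in which again only \<open>[e\<^sub>a, e\<^sub>d] e\<^sub>b\<close> survives.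
\<close>

section \<open>Alternating binomial sums\<close>

text \<open>With \<open>E\<close> the shift of sequences, this is \<open>(1 - E)^n f\<close> at 0.
  The coefficients are images of integers, hence central, so sums can be pulled through products of
  noncommuting factors.\<close>

definition alt_sum :: "nat \<Rightarrow> (nat \<Rightarrow> 'a::ring_1) \<Rightarrow> 'a" where
  "alt_sum n f = (\<Sum>i=0..n. of_int ((- 1) ^ i * int (n choose i)) * f i)"

lemma alt_sum_0 [simp]: "alt_sum 0 f = f 0"
  by (simp add: alt_sum_def)

lemma alt_sum_zero [simp]: "alt_sum n (\<lambda>i. 0) = 0"
  by (simp add: alt_sum_def)

lemma alt_sum_add: "alt_sum n (\<lambda>i. f i + g i) = alt_sum n f + alt_sum n g"
  by (simp add: alt_sum_def distrib_left sum.distrib)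

lemma alt_sum_diff: "alt_sum n (\<lambda>i. f i - g i) = alt_sum n f - alt_sum n g"
  by (simp add: alt_sum_def right_diff_distrib sum_subtractf)

lemma alt_sum_mult_right: "alt_sum n f * c = alt_sum n (\<lambda>i. f i * c)"
  by (simp add: alt_sum_def sum_distrib_right mult.assoc)

lemma alt_sum_mult_left: "c * alt_sum n f = alt_sum n (\<lambda>i. c * f i)"
  unfolding alt_sum_def sum_distrib_left by (metis mult.assoc mult_of_int_commute)

lemma alt_sum_swap:
  "alt_sum m (\<lambda>i. alt_sum n (\<lambda>j. f i j)) = alt_sum n (\<lambda>j. alt_sum m (\<lambda>i. f i j))"
proof -
  have "alt_sum m (\<lambda>i. alt_sum n (\<lambda>j. f i j)) =
      (\<Sum>i=0..m. of_int ((- 1) ^ i * int (m choose i)) * alt_sum n (f i))"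
    by (simp add: alt_sum_def)
  also have "\<dots> = (\<Sum>i=0..m. \<Sum>j=0..n. of_int ((- 1) ^ j * int (n choose j)) *
      (of_int ((- 1) ^ i * int (m choose i)) * f i j))"
    by (simp only: alt_sum_mult_left) (simp only: alt_sum_def)
  also have "\<dots> = (\<Sum>j=0..n. \<Sum>i=0..m. of_int ((- 1) ^ j * int (n choose j)) *
      (of_int ((- 1) ^ i * int (m choose i)) * f i j))"
    by (rule sum.swap)
  also have "\<dots> = alt_sum n (\<lambda>j. alt_sum m (\<lambda>i. f i j))"
    by (simp only: alt_sum_def sum_distrib_left)
  finally show ?thesis .
qed

text \<open>Pascal's rule, that is \<open>(1 - E)^(n+1) = (1 - E)^n - (1 - E)^n E\<close>.\<close>

lemma alt_sum_Suc: "alt_sum (Suc n) f = alt_sum n f - alt_sum n (\<lambda>i. f (Suc i))"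
proof -
  let ?c = "\<lambda>n i. of_int ((- 1) ^ i * int (n choose i)) :: 'a"
  have "alt_sum (Suc n) f = f 0 + (\<Sum>i=0..n. ?c (Suc n) (Suc i) * f (Suc i))"
    by (simp add: alt_sum_def sum.atLeast0_atMost_Suc_shift del: sum.cl_ivl_Suc binomial_Suc_Suc)
  also have "(\<Sum>i=0..n. ?c (Suc n) (Suc i) * f (Suc i)) =
      (\<Sum>i=0..n. ?c n (Suc i) * f (Suc i) - ?c n i * f (Suc i))"
    by (intro sum.cong refl) (simp add: algebra_simps)
  also have "f 0 + \<dots> = (f 0 + (\<Sum>i=0..n. ?c n (Suc i) * f (Suc i))) - alt_sum n (\<lambda>i. f (Suc i))"
    by (simp add: sum_subtractf alt_sum_def)
  also have "f 0 + (\<Sum>i=0..n. ?c n (Suc i) * f (Suc i)) = (\<Sum>i=0..Suc n. ?c n i * f i)"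
    by (simp add: sum.atLeast0_atMost_Suc_shift del: sum.cl_ivl_Suc)
  also have "\<dots> = alt_sum n f"
    by (simp add: alt_sum_def binomial_eq_0)
  finally show ?thesis .
qed

text \<open>The Vandermonde convolution in operator form:
  \<open>(1 - E)^m (1 - E)^n = (1 - E)^(m+n)\<close>.\<close>

lemma alt_sum_alt_sum: "alt_sum m (\<lambda>i. alt_sum n (\<lambda>j. f (i + j))) = alt_sum (m + n) f"
proof (induction m arbitrary: f)
  case (Suc m)
  from Suc [of f] Suc [of "\<lambda>i. f (Suc i)"] show ?case
    by (simp add: alt_sum_Suc)
qed simp

text \<open>Second differences annihilate linear functions. In the applications \<open>x\<close> is
  a product of basis elements whose indices are free of the summation variable.\<close>

lemma alt_sum_linear_eq_0:
  assumes "n \<ge> 2"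
  shows "alt_sum n (\<lambda>i. of_int (a + b * int i) * x) = 0"
proof -
  obtain l where "n = Suc (Suc l)"
    using assms by (metis add_2_eq_Suc le_Suc_ex)
  moreover have "alt_sum l (\<lambda>i. of_int (a + b * int i) * x)
      - alt_sum l (\<lambda>i. of_int (a + b * int (Suc i)) * x)
      = alt_sum l (\<lambda>i. - of_int b * x)" for a b
    unfolding alt_sum_diff [symmetric] by (simp add: algebra_simps)
  \<comment> \<open>The first difference is the same constant at \<open>a\<close> and at
    \<open>a + b\<close>, so the second difference vanishes.\<close>
  from this [of a b] this [of "a + b" b] have
    "alt_sum l (\<lambda>i. of_int (a + b * int i) * x) - alt_sum l (\<lambda>i. of_int (a + b * int (Suc i)) * x)
      = alt_sum l (\<lambda>i. of_int (a + b * int (Suc i)) * x)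
      - alt_sum l (\<lambda>i. of_int (a + b * int (Suc (Suc i))) * x)"
    by (simp add: algebra_simps)
  ultimately show ?thesis
    by (simp only: alt_sum_Suc diff_self)
qed

text \<open>The absorption identity \<open>i (n+1 choose i) = (n+1) (n choose i-1)\<close>: a factor
  \<open>i\<close> lowers the order by one and shifts \<open>f\<close>, and the shift brings the
  sign.\<close>

lemma alt_sum_index_mult:
  "alt_sum (Suc n) (\<lambda>i. of_int (int i) * f i) = - of_nat (Suc n) * alt_sum n (\<lambda>i. f (Suc i))"
proof (induction n arbitrary: f)
  case 0
  show ?case by (simp add: alt_sum_Suc)
next
  case (Suc n)
  have "alt_sum (Suc (Suc n)) (\<lambda>i. of_int (int i) * f i)
      = alt_sum (Suc n) (\<lambda>i. of_int (int i) * f i)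
      - alt_sum (Suc n) (\<lambda>i. of_int (int i) * f (Suc i)) - alt_sum (Suc n) (\<lambda>i. f (Suc i))"
    by (subst alt_sum_Suc) (simp add: distrib_right alt_sum_add)
  also have "\<dots> = - of_nat (Suc (Suc n)) * alt_sum (Suc n) (\<lambda>i. f (Suc i))"
    unfolding Suc.IH by (simp add: alt_sum_Suc algebra_simps mult_2)
  finally show ?case .
qed

text \<open>Reversal multiplies the signs by \<open>(-1)^n\<close>, which is 1 for even
  \<open>n\<close>.\<close>

lemma alt_sum_rev:
  assumes "even n"
  shows "alt_sum n f = alt_sum n (\<lambda>i. f (n - i))"
proof -
  have "alt_sum n f = (\<Sum>i=0..n. of_int ((- 1) ^ (n - i) * int (n choose (n - i))) * f (n - i))"
    unfolding alt_sum_def by (subst sum.atLeastAtMost_rev) simp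
  also have "\<dots> = alt_sum n (\<lambda>i. f (n - i))"
    unfolding alt_sum_def using assms
    by (intro sum.cong refl) (auto simp: binomial_symmetric [symmetric] minus_one_power_iff)
  finally show ?thesis .
qed

text \<open>The indices \<open>i\<close>, \<open>i'\<close>, \<open>j\<close>, \<open>j'\<close>
  expand the factors \<open>(1 - z/x)^m\<close>, \<open>(1 - y/x)^m\<close>,
  \<open>(1 - w/y)^r\<close>, \<open>(1 - w/z)^r\<close> in this order.\<close>

definition alt_sum4 ::
    "nat \<Rightarrow> nat \<Rightarrow> (nat \<Rightarrow> nat \<Rightarrow> nat \<Rightarrow> nat \<Rightarrow> 'a::ring_1) \<Rightarrow> 'a" where
  "alt_sum4 m r f =
     alt_sum m (\<lambda>i. alt_sum m (\<lambda>i'. alt_sum r (\<lambda>j. alt_sum r (\<lambda>j'. f i i' j j'))))"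

lemma alt_sum4_add:
  "alt_sum4 m r (\<lambda>i i' j j'. f i i' j j' + g i i' j j') = alt_sum4 m r f + alt_sum4 m r g"
  by (simp add: alt_sum4_def alt_sum_add)

lemma alt_sum4_diff:
  "alt_sum4 m r (\<lambda>i i' j j'. f i i' j j' - g i i' j j') = alt_sum4 m r f - alt_sum4 m r g"
  by (simp add: alt_sum4_def alt_sum_diff)

lemma alt_sum4_mult_left:
  "c * alt_sum4 m r f = alt_sum4 m r (\<lambda>i i' j j'. c * f i i' j j')"
  by (simp add: alt_sum4_def alt_sum_mult_left)

text \<open>This is the symmetry of the weights in \<open>y\<close> and \<open>z\<close>: exchanging
  both pairs at once interchanges the offsets \<open>i' - j\<close> and \<open>i - j'\<close> of the
  two middle factors and fixes the outer ones.\<close>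

lemma alt_sum4_swap: "alt_sum4 m r (\<lambda>i i' j j'. f i' i j' j) = alt_sum4 m r f"
  unfolding alt_sum4_def
  by (subst alt_sum_swap [of m m], subst alt_sum_swap [of r r]) (rule refl)

text \<open>Brings \<open>i\<close> innermost, so that a vanishing sum over \<open>i\<close> can be
  applied.\<close>

lemma alt_sum4_rotate:
  "alt_sum4 m r f =
     alt_sum m (\<lambda>i'. alt_sum r (\<lambda>j. alt_sum r (\<lambda>j'. alt_sum m (\<lambda>i. f i i' j j'))))"
  unfolding alt_sum4_def
  by (subst alt_sum_swap [of m m], subst alt_sum_swap [of m r], subst alt_sum_swap [of m r]) (rule refl)

text \<open>Setting \<open>z = y\<close> in the weights: once the middle factors have merged into
  one, each pair of binomial powers becomes a single power of doubled exponent.\<close>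

lemma alt_sum4_diagonal:
  "alt_sum4 m r (\<lambda>i i' j j'. f (i + i') (j + j'))
     = alt_sum (2 * m) (\<lambda>i. alt_sum (2 * r) (f i))"
  unfolding alt_sum4_def alt_sum_alt_sum mult_2 [symmetric]
  using alt_sum_alt_sum [where f = "\<lambda>i. alt_sum (2 * r) (f i)" and m = m and n = m]
  by (simp add: mult_2)

section \<open>Products of differentiators\<close>

lemma differentiator_alt_sum:
  "differentiator m k s = alt_sum m (\<lambda>i. uea_basis (k - int i) * uea_basis (s + int i))"
  by (simp add: differentiator_def alt_sum_def mult.assoc)

lemma alternating_double_sum:
  "(\<Sum>i=0..m. \<Sum>j=0..r. (- 1) ^ (i + j) * of_nat (m choose i) * of_nat (r choose j) * f i j)
     = alt_sum m (\<lambda>i. alt_sum r (f i))" for f :: "nat \<Rightarrow> nat \<Rightarrow> 'a::ring_1"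
proof -
  have "(- 1) ^ (i + j) * of_nat (m choose i) * of_nat (r choose j) * x
     = of_int ((- 1) ^ i * int (m choose i)) * (of_int ((- 1) ^ j * int (r choose j)) * x)"
    for i j and x :: 'a
  proof -
    have "(- 1) ^ (i + j) * of_nat (m choose i) * of_nat (r choose j) * x
      = of_int ((- 1) ^ (i + j) * int (m choose i) * int (r choose j)) * x"
      by simp
    also have "(- 1) ^ (i + j) * int (m choose i) * int (r choose j)
      = ((- 1) ^ i * int (m choose i)) * ((- 1) ^ j * int (r choose j))"
      by (simp add: power_add)
    finally show ?thesis
      by (simp only: of_int_mult mult.assoc)
  qed
  then show ?thesis
    by (simp only: alt_sum_def sum_distrib_left)
qed

lemma basis_swap:
  "uea_basis a * uea_basis b = uea_basis b * uea_basis a + of_int (b - a) * uea_basis (a + b)"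
  using uea_basis_commutator [of a b] by (simp add: algebra_simps)

lemma differentiator_product_sum:
  "alt_sum m (\<lambda>i. alt_sum r (\<lambda>j.
      differentiator m (k - int i) (s - int j) * differentiator r (q + int i) (p + int j)))
   = alt_sum4 m r (\<lambda>i i' j j'. uea_basis (k - int i - int i') * uea_basis (s - int j + int i') *
       (uea_basis (q + int i - int j') * uea_basis (p + int j + int j')))"
  unfolding differentiator_alt_sum alt_sum_mult_right unfolding alt_sum_mult_left alt_sum4_def
  by (subst alt_sum_swap [of r m]) (rule refl)

text \<open>Moving \<open>e\<^sub>c\<close> to the right past \<open>e\<^sub>d e\<^sub>a\<close> produces only terms that vanish after summation.\<close>

lemma differentiator_product_sum_rev:
  assumes "m \<ge> 2" "r \<ge> 2"
  shows "alt_sum m (\<lambda>i. alt_sum r (\<lambda>j.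
      differentiator r (q + int i) (p + int j) * differentiator m (k - int i) (s - int j)))
   = alt_sum4 m r (\<lambda>i i' j j'. uea_basis (p + int j + int j') * uea_basis (k - int i - int i') *
       (uea_basis (q + int i - int j') * uea_basis (s - int j + int i')))"
proof -
  let ?a = "\<lambda>i i'. k - int i - int i'" and ?b = "\<lambda>i' j. s - int j + int i'"
  let ?c = "\<lambda>i j'. q + int i - int j'" and ?d = "\<lambda>j j'. p + int j + int j'"
  let ?e = uea_basis
  have "alt_sum m (\<lambda>i. alt_sum r (\<lambda>j.
      differentiator r (q + int i) (p + int j) * differentiator m (k - int i) (s - int j)))
   = alt_sum4 m r (\<lambda>i i' j j'. ?e (?c i j') * ?e (?d j j') * (?e (?a i i') * ?e (?b i' j)))"
    unfolding differentiator_alt_sum alt_sum_mult_left unfolding alt_sum_mult_right alt_sum4_def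
    by (subst alt_sum_swap [of r m]) (rule refl)
  also have "\<dots> = alt_sum4 m r (\<lambda>i i' j j'.
        ?e (?d j j') * ?e (?a i i') * (?e (?c i j') * ?e (?b i' j))
      + of_int (?d j j' - ?c i j') * (?e (?c i j' + ?d j j') * (?e (?a i i') * ?e (?b i' j)))
      + of_int (?a i i' - ?c i j') * (?e (?d j j') * ?e (?c i j' + ?a i i') * ?e (?b i' j)))"
  proof -
    have "?e c * ?e d * (?e a * ?e b) = ?e d * ?e a * (?e c * ?e b)
      + of_int (d - c) * (?e (c + d) * (?e a * ?e b))
      + of_int (a - c) * (?e d * ?e (c + a) * ?e b)" for a b c d
    proof -
      have "?e c * ?e d * (?e a * ?e b) = ?e d * (?e c * ?e a) * ?e b
        + of_int (d - c) * (?e (c + d) * (?e a * ?e b))"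
        by (subst basis_swap [of c d]) (simp only: distrib_right mult.assoc)
      also have "?e d * (?e c * ?e a) * ?e b = ?e d * ?e a * (?e c * ?e b)
        + ?e d * of_int (a - c) * ?e (c + a) * ?e b"
        by (subst basis_swap [of c a]) (simp only: distrib_right distrib_left mult.assoc)
      finally show ?thesis
        by (simp only: mult_of_int_commute [symmetric] mult.assoc ac_simps)
    qed
    then show ?thesis
      by (intro arg_cong [where f = "alt_sum4 m r"] ext)
  qed
  also have "\<dots> = alt_sum4 m r (\<lambda>i i' j j'.
        ?e (?d j j') * ?e (?a i i') * (?e (?c i j') * ?e (?b i' j)))"
  proof -
    \<comment> \<open>The index \<open>c + d\<close> and the factors \<open>e_a\<close>,
      \<open>e_b\<close> are free of \<open>j'\<close>, while \<open>d - c\<close> is linear in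
      it.\<close>
    have "alt_sum r (\<lambda>j'. of_int (?d j j' - ?c i j') * (?e (?c i j' + ?d j j') * x)) = 0" for i j x
      using alt_sum_linear_eq_0 [OF assms(2), of "p + int j - q - int i" 2 "?e (q + int i + p + int j) * x"]
      by (simp add: algebra_simps del: of_int_add of_int_diff)
    then have "alt_sum4 m r (\<lambda>i i' j j'.
        of_int (?d j j' - ?c i j') * (?e (?c i j' + ?d j j') * (?e (?a i i') * ?e (?b i' j)))) = 0"
      unfolding alt_sum4_def by (simp only: alt_sum_zero)
    \<comment> \<open>Likewise \<open>c + a\<close>, \<open>e_d\<close> and \<open>e_b\<close> are
      free of \<open>i\<close>, while \<open>a - c\<close> is linear in it.\<close>
    moreover have "alt_sum m (\<lambda>i. of_int (?a i i' - ?c i j') * (x * ?e (?c i j' + ?a i i') * y)) = 0"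
      for i' j' x y
      using alt_sum_linear_eq_0 [OF assms(1), of "k - int i' - q + int j'" "- 2" "x * ?e (q - int j' + k - int i') * y"]
      by (simp add: algebra_simps del: of_int_add of_int_diff)
    then have "alt_sum4 m r (\<lambda>i i' j j'.
        of_int (?a i i' - ?c i j') * (?e (?d j j') * ?e (?c i j' + ?a i i') * ?e (?b i' j))) = 0"
      unfolding alt_sum4_rotate by (simp only: alt_sum_zero)
    ultimately show ?thesis
      by (simp only: alt_sum4_add add_0_right)
  qed
  finally show ?thesis .
qed

text \<open>The part of the coefficient that is odd under the exchange of the two middle factors sums to 0.\<close>

lemma alt_sum4_middle_commutator:
  fixes f :: "nat \<Rightarrow> nat \<Rightarrow> 'a::ring_1"
  shows "alt_sum4 m r (\<lambda>i i' j j'. of_int ((q + int i - int j') - (s - int j + int i')) * f (i + i') (j + j'))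
     = of_int (q - s) * alt_sum (2 * m) (\<lambda>i. alt_sum (2 * r) (f i))"
proof -
  have "alt_sum4 m r (\<lambda>i i' j j'. of_int ((q + int i - int j') - (s - int j + int i')) * f (i + i') (j + j'))
    = alt_sum4 m r (\<lambda>i i' j j'. of_int (q - s) * f (i + i') (j + j')
        + (of_int (int i - int j') * f (i + i') (j + j') - of_int (int i' - int j) * f (i + i') (j + j')))"
    unfolding left_diff_distrib [symmetric] distrib_right [symmetric] of_int_diff [symmetric] of_int_add [symmetric]
    by (simp only: algebra_simps)
  also have "\<dots> = alt_sum4 m r (\<lambda>i i' j j'. of_int (q - s) * f (i + i') (j + j'))"
    unfolding alt_sum4_add alt_sum4_diff
    using alt_sum4_swap [of m r "\<lambda>i i' j j'. of_int (int i - int j') * f (i + i') (j + j')"]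
    by (simp only: add.commute [of "_ :: nat"] diff_self add_0_right)
  also have "\<dots> = of_int (q - s) * alt_sum (2 * m) (\<lambda>i. alt_sum (2 * r) (f i))"
    unfolding alt_sum4_mult_left [symmetric] alt_sum4_diagonal ..
  finally show ?thesis .
qed

text \<open>In \<open>[e_a, e_d] e_b\<close> the variable \<open>w\<close> becomes \<open>x\<close>,
  and for even \<open>R\<close> the weight is
  \<open>(1 - y/x)^M (1 - x/y)^R = (x/y)^R (1 - y/x)^(M+R)\<close>. This explains the index shifts
  by \<open>R\<close>; the linear coefficient \<open>d - a\<close> lowers the order to
  \<open>M + R - 1\<close>.\<close>

lemma cubic_sum:
  assumes "M \<ge> 2" "R \<ge> 2" "even R"
  shows "alt_sum M (\<lambda>i. alt_sum R (\<lambda>j.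
      uea_basis (k - int i) * uea_basis (t + int i - int j) * uea_basis (p + int j)
      - uea_basis (p + int j) * uea_basis (k - int i) * uea_basis (t + int i - int j)))
   = of_int (p - k + int R) * differentiator (M + R - 1) (k + p + int R) (t - int R)
     - of_int (p - k + int M) * differentiator (M + R - 1) (k + p + int R - 1) (t - int R + 1)"
    (is "?lhs = _")
proof -
  let ?e = uea_basis
  define g where "g n = ?e (k + p + int R - int n) * ?e (t - int R + int n)" for n
  have comm: "?e a * ?e b * ?e d - ?e d * ?e a * ?e b
      = of_int (d - a) * (?e (a + d) * ?e b) + of_int (d - b) * (?e a * ?e (b + d))" for a b d
  proof -
    have "?e a * (?e b * ?e d) = ?e a * ?e d * ?e b + ?e a * of_int (d - b) * ?e (b + d)"
      by (subst basis_swap [of b d]) (simp only: distrib_left mult.assoc)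
    also have "?e a * ?e d * ?e b = ?e d * ?e a * ?e b + of_int (d - a) * (?e (a + d) * ?e b)"
      by (subst basis_swap [of a d]) (simp only: distrib_right mult.assoc)
    finally show ?thesis
      by (simp only: mult_of_int_commute [symmetric] mult.assoc) simp
  qed
  \<comment> \<open>The bracket \<open>[e_b, e_d]\<close> contributes nothing: \<open>b + d\<close>
    is free of \<open>j\<close> and \<open>d - b\<close> is linear in \<open>j\<close>.\<close>
  have zero: "alt_sum R (\<lambda>j. of_int ((p + int j) - (t + int i - int j))
        * (x * ?e ((t + int i - int j) + (p + int j)))) = 0" for i x
    using alt_sum_linear_eq_0 [OF assms(2), of "p - t - int i" 2 "x * ?e (t + int i + p)"]
    by (simp add: algebra_simps del: of_int_add of_int_diff)
  have "?lhs = alt_sum M (\<lambda>i. alt_sum R (\<lambda>j. of_int ((p + int j) - (k - int i))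
      * (?e ((k - int i) + (p + int j)) * ?e (t + int i - int j))))"
    unfolding comm alt_sum_add zero by simp
  \<comment> \<open>Replacing \<open>j\<close> by \<open>R - j\<close> makes both basis indices
    depend on \<open>i + j\<close> only and turns \<open>d - a\<close> into
    \<open>p - k + R + i - j\<close>.\<close>
  also have "\<dots> = alt_sum M (\<lambda>i. alt_sum R (\<lambda>j. of_int (p - k + int R) * g (i + j)
      + of_int (int i) * g (i + j) - of_int (int j) * g (i + j)))"
  proof -
    have "alt_sum R (\<lambda>j. of_int ((p + int j) - (k - int i))
        * (?e ((k - int i) + (p + int j)) * ?e (t + int i - int j)))
      = alt_sum R (\<lambda>j. of_int (p - k + int R) * g (i + j)
      + of_int (int i) * g (i + j) - of_int (int j) * g (i + j))" for i
      unfolding distrib_right [symmetric] left_diff_distrib [symmetric] of_int_diff [symmetric] of_int_add [symmetric]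
      unfolding alt_sum_rev [OF assms(3), of "\<lambda>j. of_int ((p + int j) - (k - int i)) * _ j"]
      unfolding alt_sum_def
      by (intro sum.cong refl arg_cong2 [where f = "(*)"])
        (simp_all add: g_def algebra_simps of_nat_diff del: of_int_add of_int_diff)
    then show ?thesis by (simp only:)
  qed
  also have "\<dots> = of_int (p - k + int R) * alt_sum (M + R) g
      - of_nat M * alt_sum (M + R - 1) (\<lambda>n. g (Suc n))
      + of_nat R * alt_sum (M + R - 1) (\<lambda>n. g (Suc n))"
  proof -
    obtain M' R' where MR: "M = Suc M'" "R = Suc R'"
      using assms by (metis Suc_le_D numeral_2_eq_2)
    have "alt_sum M (\<lambda>i. alt_sum R (\<lambda>j. of_int (int i) * g (i + j)))
        = - of_nat M * alt_sum (M + R - 1) (\<lambda>n. g (Suc n))"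
      unfolding MR(1) alt_sum_mult_left [symmetric] alt_sum_index_mult
      using alt_sum_alt_sum [of M' R "\<lambda>n. g (Suc n)"] by simp
    moreover have "alt_sum M (\<lambda>i. alt_sum R (\<lambda>j. of_int (int j) * g (i + j)))
        = - of_nat R * alt_sum (M + R - 1) (\<lambda>n. g (Suc n))"
      unfolding MR(2) alt_sum_index_mult unfolding alt_sum_mult_left [symmetric]
      using alt_sum_alt_sum [of M R' "\<lambda>n. g (Suc n)"] by simp
    ultimately show ?thesis
      unfolding alt_sum_add alt_sum_diff
      unfolding alt_sum_mult_left [of "of_int (p - k + int R)", symmetric] alt_sum_alt_sum
      by simp
  qed
  \<comment> \<open>Lowering the remaining sum to order \<open>M + R - 1\<close> lets the shifted
    terms combine: their coefficient is \<open>-(p - k + R) - M + R = -(p - k + M)\<close>.\<close>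
  also have "alt_sum (M + R) g = alt_sum (M + R - 1) g - alt_sum (M + R - 1) (\<lambda>n. g (Suc n))"
    using alt_sum_Suc [of "M + R - 1" g] assms by simp
  also have "alt_sum (M + R - 1) g = differentiator (M + R - 1) (k + p + int R) (t - int R)"
    by (simp add: differentiator_alt_sum g_def [abs_def])
  also have "alt_sum (M + R - 1) (\<lambda>n. g (Suc n))
      = differentiator (M + R - 1) (k + p + int R - 1) (t - int R + 1)"
    by (simp add: differentiator_alt_sum g_def algebra_simps)
  finally show ?thesis
    by (simp add: algebra_simps)
qed

section \<open>Comparison of the two orders of the middle factors\<close>

theorem theorem3p3:
  fixes m r :: nat and k s p q :: int
  assumes "m \<ge> 2" and "r \<ge> 2"
  shows "(\<Sum>i=0..m. \<Sum>j=0..r. (- 1) ^ (i + j) * of_nat (m choose i) * of_nat (r choose j) *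
            (anticommutator (differentiator m (k - int i) (s - int j)) (differentiator r (q + int i) (p + int j))
             - anticommutator (differentiator m (k - int i) (q - int j)) (differentiator r (s + int i) (p + int j))))
         = of_int (q - s) *
             (of_int (p - k + 2 * int r) *
                differentiator (2 * m + 2 * r - 1) (k + p + 2 * int r) (s + q - 2 * int r)
              - of_int (p - k + 2 * int m) *
                differentiator (2 * m + 2 * r - 1) (k + p + 2 * int r - 1) (s + q - 2 * int r + 1))"
proof -
  let ?e = uea_basis
  let ?a = "\<lambda>i i'. k - int i - int i'" and ?d = "\<lambda>j j'. p + int j + int j'"
  let ?b = "\<lambda>s i' j. s - int j + int i'" and ?c = "\<lambda>q i j'. q + int i - int j'"
  \<comment> \<open>\<open>X\<close> collects the products in the order \<open>m\<close>,
    \<open>r\<close>; \<open>Y\<close> collects the reversed products, with \<open>e_c\<close>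
    already moved next to \<open>e_b\<close>.\<close>
  define X where "X s q = alt_sum4 m r (\<lambda>i i' j j'.
      ?e (?a i i') * ?e (?b s i' j) * (?e (?c q i j') * ?e (?d j j')))" for s q
  define Y where "Y s q = alt_sum4 m r (\<lambda>i i' j j'.
      ?e (?d j j') * ?e (?a i i') * (?e (?c q i j') * ?e (?b s i' j)))" for s q
  let ?f = "\<lambda>i j. ?e (k - int i) * ?e (s + q + int i - int j) * ?e (p + int j)"
  let ?g = "\<lambda>i j. ?e (p + int j) * ?e (k - int i) * ?e (s + q + int i - int j)"
  \<comment> \<open>After the relabelling, \<open>X q s\<close> has the same four factors as
    \<open>X s q\<close> with the middle two interchanged, so the difference can be taken
    termwise.\<close>
  have X_swap: "X q s = alt_sum4 m r (\<lambda>i i' j j'.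
      ?e (?a i i') * ?e (?c q i j') * (?e (?b s i' j) * ?e (?d j j')))"
    unfolding X_def by (subst alt_sum4_swap [symmetric]) (simp add: algebra_simps)
  have "X s q - X q s = alt_sum4 m r (\<lambda>i i' j j'.
      of_int (?c q i j' - ?b s i' j) * ?f (i + i') (j + j'))"
  proof -
    have "?e a * ?e b * (?e c * ?e d) - ?e a * ?e c * (?e b * ?e d)
        = of_int (c - b) * (?e a * ?e (b + c) * ?e d)" for a b c d
    proof -
      have "?e a * ?e b * (?e c * ?e d) - ?e a * ?e c * (?e b * ?e d)
        = ?e a * (?e b * ?e c - ?e c * ?e b) * ?e d"
        by (simp only: algebra_simps)
      also have "\<dots> = ?e a * of_int (c - b) * ?e (b + c) * ?e d"
        by (simp only: uea_basis_commutator mult.assoc)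
      finally show ?thesis
        by (simp only: mult_of_int_commute [symmetric] mult.assoc)
    qed
    moreover have "?b s i' j + ?c q i j' = s + q + int (i + i') - int (j + j')"
      "?a i i' = k - int (i + i')" "?d j j' = p + int (j + j')" for i i' j j'
      by simp_all
    ultimately show ?thesis
      unfolding X_swap unfolding X_def alt_sum4_diff [symmetric] by (simp only:)
  qed
  then have X: "X s q - X q s = of_int (q - s) * alt_sum (2 * m) (\<lambda>i. alt_sum (2 * r) (?f i))"
    using alt_sum4_middle_commutator [of m r q s ?f] by (rule trans)
  have Y_swap: "Y q s = alt_sum4 m r (\<lambda>i i' j j'.
      ?e (?d j j') * ?e (?a i i') * (?e (?b s i' j) * ?e (?c q i j')))"
    unfolding Y_def by (subst alt_sum4_swap [symmetric]) (simp add: algebra_simps)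
  have "Y q s - Y s q = alt_sum4 m r (\<lambda>i i' j j'.
      of_int (?c q i j' - ?b s i' j) * ?g (i + i') (j + j'))"
  proof -
    have "?e d * ?e a * (?e b * ?e c) - ?e d * ?e a * (?e c * ?e b)
        = of_int (c - b) * (?e d * ?e a * ?e (b + c))" for a b c d
    proof -
      have "?e d * ?e a * (?e b * ?e c) - ?e d * ?e a * (?e c * ?e b)
        = ?e d * ?e a * of_int (c - b) * ?e (b + c)"
        by (simp only: right_diff_distrib [symmetric] uea_basis_commutator mult.assoc)
      then show ?thesis
        by (simp only: mult_of_int_commute [symmetric] mult.assoc)
    qed
    moreover have "?b s i' j + ?c q i j' = s + q + int (i + i') - int (j + j')"
      "?a i i' = k - int (i + i')" "?d j j' = p + int (j + j')" for i i' j j'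
      by simp_all
    ultimately show ?thesis
      unfolding Y_swap unfolding Y_def alt_sum4_diff [symmetric] by (simp only:)
  qed
  then have Y: "Y q s - Y s q = of_int (q - s) * alt_sum (2 * m) (\<lambda>i. alt_sum (2 * r) (?g i))"
    using alt_sum4_middle_commutator [of m r q s ?g] by (rule trans)
  have "(\<Sum>i=0..m. \<Sum>j=0..r. (- 1) ^ (i + j) * of_nat (m choose i) * of_nat (r choose j) *
            (anticommutator (differentiator m (k - int i) (s - int j)) (differentiator r (q + int i) (p + int j))
             - anticommutator (differentiator m (k - int i) (q - int j)) (differentiator r (s + int i) (p + int j))))
      = (X s q + Y s q) - (X q s + Y q s)"
    unfolding alternating_double_sum anticommutator_def alt_sum_add alt_sum_diff
      differentiator_product_sum differentiator_product_sum_rev [OF assms] X_def Y_def ..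
  \<comment> \<open>In \<open>Y\<close> the factor \<open>e_c\<close> precedes \<open>e_b\<close>,
    opposite to \<open>X\<close>. With this grouping both differences carry the coefficient
    \<open>c - b\<close>, and the terms combine to \<open>[e_a e_b, e_d]\<close>.\<close>
  also have "\<dots> = (X s q - X q s) - (Y q s - Y s q)"
    by simp
  also have "\<dots> = of_int (q - s) * alt_sum (2 * m) (\<lambda>i. alt_sum (2 * r) (\<lambda>j. ?f i j - ?g i j))"
    unfolding X Y alt_sum_diff by (simp only: right_diff_distrib)
  also have "\<dots> = of_int (q - s) *
             (of_int (p - k + 2 * int r) *
                differentiator (2 * m + 2 * r - 1) (k + p + 2 * int r) (s + q - 2 * int r)
              - of_int (p - k + 2 * int m) *
                differentiator (2 * m + 2 * r - 1) (k + p + 2 * int r - 1) (s + q - 2 * int r + 1))"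
    using cubic_sum [of "2 * m" "2 * r" k "s + q" p] assms by simp
  finally show ?thesis .
qed

end
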